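(* Let $n=p_1^{\alpha_1}p_2^{\alpha_2}p_3^{\alpha_3}$, where $\alpha_1,\alpha_2,\alpha_3$ are positive integers and $p_1<p_2<p_3$ are primes. Then $$\delta(\mathcal{P}(C_n))=\min\{\deg(p_2^{\alpha_2}),\ \deg(p_3^{\alpha_3})\}.$$
   Context: For a finite group $G$, the power graph $\mathcal{P}(G)$ is the simple undirected graph with vertex set $G$ in which two distinct vertices are adjacent if one is an integral power of the other. $C_n$ denotes the cyclic group of order $n$, identified with $\mathbb{Z}_n=\{0,1,\ldots,n-1\}$, so a positive divisor $d<n$ of $n$ is regarded as the element $d\in\mathbb{Z}_n$. $\deg(a)$ is the degree of vertex $a$ in $\mathcal{P}(C_n)$ and $\delta$ denotes minimum degree. *)

theory Defs
  imports "HOL-Computational_Algebra.Primes"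
begin

text \<open>Power graph of the cyclic group C_n, identified with Z_n = {0,...,n-1} (additive).
  An integral power of a is k*a mod n for an integer k.\<close>

definition pg_adj :: "nat \<Rightarrow> nat \<Rightarrow> nat \<Rightarrow> bool" where
  "pg_adj n a b \<longleftrightarrow> a \<noteq> b \<and>
     ((\<exists>k::int. int b = (k * int a) mod int n) \<or> (\<exists>k::int. int a = (k * int b) mod int n))"

definition pg_deg :: "nat \<Rightarrow> nat \<Rightarrow> nat" where
  "pg_deg n a = card {b \<in> {0..<n}. pg_adj n a b}"

definition pg_min_deg :: "nat \<Rightarrow> nat" where
  "pg_min_deg n = Min (pg_deg n ` {0..<n})"

end

theory Submission
  imports Defs Complex_Main "HOL-Number_Theory.Cong"
begin

text \<open>
  Two residues are adjacent or equal iff their gcds with \<open>n\<close> are comparable under divisibility,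
  so the degree of \<open>c\<close> depends only on \<open>gcd c n = \<Prod> p\<^sub>i ^ b\<^sub>i\<close>. By the Chinese remainder theorem
  the degree plus one is \<open>\<Prod> x\<^sub>i + \<Prod> (q\<^sub>i - y\<^sub>i) - \<Prod> (x\<^sub>i - y\<^sub>i)\<close>, where \<open>q\<^sub>i = p\<^sub>i ^ a\<^sub>i\<close>,
  \<open>x\<^sub>i = p\<^sub>i ^ (a\<^sub>i - b\<^sub>i)\<close>, and \<open>y\<^sub>i = x\<^sub>i / p\<^sub>i\<close> if \<open>b\<^sub>i < a\<^sub>i\<close>, \<open>y\<^sub>i = 0\<close> otherwise.
  As a function of a single exponent \<open>b\<close> this is \<open>x * A + (q - y) * B - (x - y) * C\<close>; it is least
  at \<open>b = 0\<close> if \<open>p * (A - C) \<le> B - C\<close>, and least at \<open>b = a\<close> if \<open>B = C\<close>.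
  The exponents are now moved one at a time without increasing the degree.
  Unless \<open>b\<^sub>2 = b\<^sub>3 = 0\<close>, lower \<open>b\<^sub>1\<close> to \<open>0\<close>; then, if \<open>b\<^sub>3 > 0\<close>, lower \<open>b\<^sub>2\<close> to \<open>0\<close> and raise
  \<open>b\<^sub>3\<close> to \<open>a\<^sub>3\<close>, and if \<open>b\<^sub>3 = 0\<close>, raise \<open>b\<^sub>2\<close> to \<open>a\<^sub>2\<close>. If \<open>b\<^sub>2 = b\<^sub>3 = 0\<close>, raise \<open>b\<^sub>1\<close> to \<open>a\<^sub>1\<close>
  and compare \<open>p\<^sub>1 ^ a\<^sub>1\<close> with \<open>p\<^sub>3 ^ a\<^sub>3\<close> directly.
  The only arithmetic input beyond \<open>p\<^sub>1 < p\<^sub>2 < p\<^sub>3\<close> is \<open>p\<^sub>2 + 2 \<le> p\<^sub>3\<close>.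
\<close>

section \<open>Adjacency and degree in terms of gcds with \<open>n\<close>\<close>

text \<open>The multiples of \<open>a\<close> modulo \<open>n\<close> form the subgroup generated by
  \<open>gcd a n\<close>; Bezout coefficients supply the multiplier \<open>k\<close>.\<close>

lemma multiple_mod_iff_gcd_dvd:
  fixes a b n :: nat
  assumes "b < n"
  shows "(\<exists>k::int. int b = (k * int a) mod int n) \<longleftrightarrow> gcd a n dvd gcd b n"
proof
  assume "\<exists>k::int. int b = (k * int a) mod int n"
  then obtain k :: int where k: "int b = (k * int a) mod int n" by blast
  have "int (gcd a n) dvd (k * int a) mod int n"
    by (intro dvd_mod dvd_mult) (simp_all only: int_dvd_int_iff gcd_dvd1 gcd_dvd2)
  then have "gcd a n dvd b" using k by (metis int_dvd_int_iff)
  then show "gcd a n dvd gcd b n" by simp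
next
  assume "gcd a n dvd gcd b n"
  then have "gcd a n dvd b" by simp
  then obtain c where c: "b = gcd a n * c" by blast
  obtain u v where uv: "u * int a + v * int n = gcd (int a) (int n)"
    using bezout_int by blast
  have "int b = (u * int a + v * int n) * int c"
    using c uv by simp
  then have "int b = (u * int c) * int a + (v * int c) * int n"
    by (simp add: algebra_simps)
  then have "int b mod int n = ((u * int c) * int a) mod int n"
    by simp
  moreover have "int b mod int n = int b" using assms by simp
  ultimately show "\<exists>k::int. int b = (k * int a) mod int n"
    by (intro exI[of _ "u * int c"]) linarith
qed

lemma pg_deg_eq_card_comparable:
  assumes "a < n"
  shows "pg_deg n a + 1 = card {b. b < n \<and> (gcd a n dvd gcd b n \<or> gcd b n dvd gcd a n)}"
    (is "_ = card ?N")
proof -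
  have "{b \<in> {0..<n}. pg_adj n a b} = ?N - {a}"
    unfolding pg_adj_def using multiple_mod_iff_gcd_dvd assms by auto
  moreover have "a \<in> ?N" using assms by simp
  then have "card ?N = Suc (card (?N - {a}))" by (intro card.remove) simp_all
  ultimately show ?thesis by (simp add: pg_deg_def)
qed

text \<open>Inclusion-exclusion: by antisymmetry of divisibility, the multiples and the divisors of
  \<open>d\<close> overlap only in \<open>d\<close>.\<close>

lemma card_comparable:
  fixes n d :: nat
  shows "card {b. b < n \<and> (d dvd gcd b n \<or> gcd b n dvd d)} + card {b. b < n \<and> gcd b n = d}
    = card {b. b < n \<and> d dvd gcd b n} + card {b. b < n \<and> gcd b n dvd d}"
proof -
  let ?A = "{b. b < n \<and> d dvd gcd b n}" and ?B = "{b. b < n \<and> gcd b n dvd d}"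
  have "?A \<union> ?B = {b. b < n \<and> (d dvd gcd b n \<or> gcd b n dvd d)}" by blast
  moreover have "?A \<inter> ?B = {b. b < n \<and> gcd b n = d}"
    by (auto intro: dvd_antisym)
  ultimately show ?thesis
    using card_Un_Int[of ?A ?B] by simp
qed

section \<open>Factoring counts over coprime moduli\<close>

lemma card_chinese_remainder:
  fixes m k :: nat
  assumes "coprime m k" "m > 0" "k > 0"
  shows "card {b. b < m * k \<and> P (b mod m) \<and> Q (b mod k)}
    = card {b. b < m \<and> P b} * card {b. b < k \<and> Q b}"
proof -
  let ?f = "\<lambda>b. (b mod m, b mod k)"
  let ?L = "{b. b < m * k \<and> P (b mod m) \<and> Q (b mod k)}"
  have "inj_on ?f ?L"
  proof (rule inj_onI)
    fix b c assume b: "b \<in> ?L" and c: "c \<in> ?L" and e: "?f b = ?f c"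
    then have "[b = c] (mod m)" "[b = c] (mod k)" by (simp_all add: cong_def)
    then have "[b = c] (mod m * k)" using assms(1) by (rule coprime_cong_mult_nat)
    then show "b = c" using b c by (simp add: cong_def)
  qed
  moreover have "?f ` ?L = {b. b < m \<and> P b} \<times> {b. b < k \<and> Q b}" (is "_ = ?R")
  proof
    show "?f ` ?L \<subseteq> ?R" using assms by auto
    show "?R \<subseteq> ?f ` ?L"
    proof
      fix z assume "z \<in> ?R"
      then obtain u v where z: "z = (u, v)" "u < m" "v < k" "P u" "Q v" by blast
      obtain b where b: "[b = u] (mod m)" "[b = v] (mod k)"
        using binary_chinese_remainder_nat[OF assms(1)] by blast
      let ?b = "b mod (m * k)"
      have "?b mod m = u" "?b mod k = v"
        using b z by (simp_all add: cong_def mod_mod_cancel)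
      then show "z \<in> ?f ` ?L"
        using z assms by (intro image_eqI[of _ _ ?b]) simp_all
    qed
  qed
  ultimately show ?thesis
    using card_image[of ?f ?L] by (simp only: card_cartesian_product)
qed

lemma gcd_mult_coprime:
  fixes b m k :: nat
  assumes "coprime m k"
  shows "gcd b (m * k) = gcd b m * gcd b k"
proof (rule dvd_antisym)
  obtain d e where de: "gcd b (m * k) = d * e" "d dvd m" "e dvd k"
    using division_decomp[of "gcd b (m * k)" m k] by auto
  then have "d dvd b" "e dvd b"
    by (metis dvd_mult_left dvd_mult_right gcd_dvd1)+
  then show "gcd b (m * k) dvd gcd b m * gcd b k"
    using de by (simp add: mult_dvd_mono)
  have "coprime (gcd b m) (gcd b k)"
    using assms by (meson coprime_divisors gcd_dvd2)
  then show "gcd b m * gcd b k dvd gcd b (m * k)"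
    by (simp add: divides_mult mult_dvd_mono)
qed

text \<open>Common source of the three product formulas below: a condition on the gcd that splits
  over divisors of \<open>m\<close> and \<open>k\<close> becomes a pair of independent conditions on
  \<open>b mod m\<close> and \<open>b mod k\<close>.\<close>

lemma card_gcd_mult:
  fixes m k :: nat
  assumes "coprime m k" "m > 0" "k > 0"
    and R: "\<And>d e. d dvd m \<Longrightarrow> e dvd k \<Longrightarrow> R (d * e) \<longleftrightarrow> P d \<and> Q e"
  shows "card {b. b < m * k \<and> R (gcd b (m * k))}
    = card {b. b < m \<and> P (gcd b m)} * card {b. b < k \<and> Q (gcd b k)}"
proof -
  have "R (gcd b (m * k)) \<longleftrightarrow> P (gcd (b mod m) m) \<and> Q (gcd (b mod k) k)" for b
    using R[of "gcd b m" "gcd b k"] assms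
    by (simp add: gcd_mult_coprime)
  then have "{b. b < m * k \<and> R (gcd b (m * k))}
    = {b. b < m * k \<and> P (gcd (b mod m) m) \<and> Q (gcd (b mod k) k)}" by simp
  then show ?thesis
    using card_chinese_remainder[OF assms(1-3), of "\<lambda>b. P (gcd b m)" "\<lambda>b. Q (gcd b k)"]
    by simp
qed

lemma mult_dvd_mult_iff_coprime:
  fixes m k d e d' e' :: nat
  assumes "coprime m k" "d dvd m" "d' dvd m" "e dvd k" "e' dvd k"
  shows "d * e dvd d' * e' \<longleftrightarrow> d dvd d' \<and> e dvd e'"
proof
  assume *: "d * e dvd d' * e'"
  have "coprime d e'" "coprime e d'"
    using assms by (meson coprime_divisors coprime_commute)+
  moreover have "d dvd d' * e'" "e dvd d' * e'"
    using * dvd_mult_left dvd_mult_right by blast+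
  ultimately show "d dvd d' \<and> e dvd e'"
    by (simp add: coprime_dvd_mult_left_iff coprime_dvd_mult_right_iff)
qed (simp add: mult_dvd_mono)

lemma mult_eq_mult_iff_coprime:
  fixes m k d e d' e' :: nat
  assumes "coprime m k" "d dvd m" "d' dvd m" "e dvd k" "e' dvd k"
  shows "d * e = d' * e' \<longleftrightarrow> d = d' \<and> e = e'"
  using mult_dvd_mult_iff_coprime[of m k d d' e e'] mult_dvd_mult_iff_coprime[of m k d' d e' e]
    assms by (metis dvd_antisym dvd_refl)

lemma card_dvd_gcd_mult:
  fixes m k d e :: nat
  assumes "coprime m k" "m > 0" "k > 0" "d dvd m" "e dvd k"
  shows "card {b. b < m * k \<and> d * e dvd gcd b (m * k)}
    = card {b. b < m \<and> d dvd gcd b m} * card {b. b < k \<and> e dvd gcd b k}"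
  by (rule card_gcd_mult[where R = "\<lambda>g. d * e dvd g" and P = "\<lambda>g. d dvd g" and Q = "\<lambda>g. e dvd g"])
    (use assms in \<open>simp_all add: mult_dvd_mult_iff_coprime[OF assms(1)]\<close>)

lemma card_gcd_dvd_mult:
  fixes m k d e :: nat
  assumes "coprime m k" "m > 0" "k > 0" "d dvd m" "e dvd k"
  shows "card {b. b < m * k \<and> gcd b (m * k) dvd d * e}
    = card {b. b < m \<and> gcd b m dvd d} * card {b. b < k \<and> gcd b k dvd e}"
  by (rule card_gcd_mult[where R = "\<lambda>g. g dvd d * e" and P = "\<lambda>g. g dvd d" and Q = "\<lambda>g. g dvd e"])
    (use assms in \<open>simp_all add: mult_dvd_mult_iff_coprime[OF assms(1)]\<close>)

lemma card_gcd_eq_mult: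
  fixes m k d e :: nat
  assumes "coprime m k" "m > 0" "k > 0" "d dvd m" "e dvd k"
  shows "card {b. b < m * k \<and> gcd b (m * k) = d * e}
    = card {b. b < m \<and> gcd b m = d} * card {b. b < k \<and> gcd b k = e}"
  by (rule card_gcd_mult[where R = "\<lambda>g. g = d * e" and P = "\<lambda>g. g = d" and Q = "\<lambda>g. g = e"])
    (use assms in \<open>simp_all add: mult_eq_mult_iff_coprime[OF assms(1)]\<close>)

section \<open>The three counts, down to a single prime power\<close>

lemma card_multiples:
  fixes m d :: nat
  assumes "d dvd m" "m > 0"
  shows "card {b. b < m \<and> d dvd b} = m div d"
proof -
  from assms obtain c where c: "m = d * c" by blast
  have "d > 0" using assms c by simp
  then have "{b. b < m \<and> d dvd b} = (\<lambda>i. d * i) ` {..<c}"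
    using c by (auto elim!: dvdE)
  moreover have "inj_on (\<lambda>i. d * i) {..<c}" using \<open>d > 0\<close> by (auto simp: inj_on_def)
  ultimately show ?thesis using c \<open>d > 0\<close> by (simp add: card_image)
qed

lemma pg_deg_real:
  assumes "a < n"
  shows "real (pg_deg n a) + 1 = real (card {b. b < n \<and> gcd a n dvd gcd b n})
    + real (card {b. b < n \<and> gcd b n dvd gcd a n}) - real (card {b. b < n \<and> gcd b n = gcd a n})"
proof -
  have "pg_deg n a + 1 + card {b. b < n \<and> gcd b n = gcd a n}
     = card {b. b < n \<and> gcd a n dvd gcd b n} + card {b. b < n \<and> gcd b n dvd gcd a n}"
    unfolding pg_deg_eq_card_comparable[OF assms] by (rule card_comparable)
  then show ?thesis by linarith
qed

text \<open>For \<open>b < a\<close> this counts the residues modulo \<open>p ^ a\<close> divisible by \<open>p ^ (b + 1)\<close>.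
  The value \<open>0\<close> at \<open>b = a\<close> reflects that divisibility of \<open>gcd c (p ^ a)\<close> by \<open>p ^ (a + 1)\<close> is
  impossible, although \<open>c = 0\<close> itself is divisible by it.\<close>

definition below :: "nat \<Rightarrow> nat \<Rightarrow> nat \<Rightarrow> real" where
  "below p a b = (if b < a then real p ^ (a - b - 1) else 0)"

lemma card_prime_power_dvd:
  fixes p a b :: nat
  assumes "prime p" "b \<le> a"
  shows "real (card {c. c < p ^ a \<and> p ^ b dvd gcd c (p ^ a)}) = real p ^ (a - b)"
proof -
  have "p ^ b dvd p ^ a" using assms(2) by (rule le_imp_power_dvd)
  then have "card {c. c < p ^ a \<and> p ^ b dvd gcd c (p ^ a)} = p ^ a div p ^ b"
    using card_multiples[of "p ^ b" "p ^ a"] assms(1) by (simp add: prime_gt_0_nat)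
  also have "\<dots> = p ^ (a - b)"
    using assms by (metis power_diff prime_gt_0_nat less_numeral_extra(3))
  finally show ?thesis by simp
qed

text \<open>The divisors of \<open>p ^ a\<close> form a chain, so one that does not divide
  \<open>p ^ b\<close> is a multiple of the next power.\<close>

lemma gcd_prime_power_dvd_iff:
  fixes p a b c :: nat
  assumes "prime p" "b \<le> a"
  shows "gcd c (p ^ a) dvd p ^ b \<longleftrightarrow> \<not> (b < a \<and> p ^ Suc b dvd gcd c (p ^ a))"
proof -
  obtain i where i: "gcd c (p ^ a) = p ^ i" "i \<le> a"
    using divides_primepow_nat[OF assms(1)] gcd_dvd2 by meson
  have "p \<ge> 2" using assms(1) by (rule prime_ge_2_nat)
  then show ?thesis using i by (auto simp: dvd_power_iff_le simp del: power_Suc)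
qed

lemma card_dvd_prime_power:
  fixes p a b :: nat
  assumes "prime p" "b \<le> a"
  shows "real (card {c. c < p ^ a \<and> gcd c (p ^ a) dvd p ^ b}) = real p ^ a - below p a b"
proof (cases "b < a")
  case False
  then show ?thesis
    using gcd_prime_power_dvd_iff[OF assms] by (simp add: below_def)
next
  case True
  let ?M = "{c. c < p ^ a \<and> p ^ Suc b dvd gcd c (p ^ a)}"
  have "{c. c < p ^ a \<and> gcd c (p ^ a) dvd p ^ b} = {..<p ^ a} - ?M"
    using gcd_prime_power_dvd_iff[OF assms] True by auto
  moreover have "?M \<subseteq> {..<p ^ a}" by auto
  ultimately have "card {c. c < p ^ a \<and> gcd c (p ^ a) dvd p ^ b} = p ^ a - card ?M"
    and "card ?M \<le> p ^ a"
    using card_Diff_subset[of ?M "{..<p ^ a}"] card_mono[of "{..<p ^ a}" ?M]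
    by (simp_all add: finite_subset)
  moreover have "real (card ?M) = below p a b"
    using card_prime_power_dvd[OF assms(1), of "Suc b" a] True by (simp add: below_def)
  ultimately show ?thesis by (simp add: of_nat_diff)
qed

lemma card_eq_prime_power:
  fixes p a b :: nat
  assumes "prime p" "b \<le> a"
  shows "real (card {c. c < p ^ a \<and> gcd c (p ^ a) = p ^ b}) = real p ^ (a - b) - below p a b"
proof -
  let ?D = "{c. c < p ^ a \<and> p ^ b dvd gcd c (p ^ a)}"
  \<comment> \<open>At \<open>b = a\<close> this set is empty, in agreement with
    \<open>below p a a = 0\<close>.\<close>
  let ?M = "{c. c < p ^ a \<and> b < a \<and> p ^ Suc b dvd gcd c (p ^ a)}"
  have "gcd c (p ^ a) = p ^ b \<longleftrightarrow> p ^ b dvd gcd c (p ^ a) \<and> gcd c (p ^ a) dvd p ^ b" for c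
    by (metis dvd_antisym dvd_refl)
  then have "{c. c < p ^ a \<and> gcd c (p ^ a) = p ^ b} = ?D - ?M"
    unfolding gcd_prime_power_dvd_iff[OF assms] by blast
  moreover have sub: "?M \<subseteq> ?D"
    using dvd_trans[OF le_imp_power_dvd[of b "Suc b" p]] by (blast intro: le_SucI)
  ultimately have "card {c. c < p ^ a \<and> gcd c (p ^ a) = p ^ b} = card ?D - card ?M"
    by (simp add: card_Diff_subset)
  moreover have "card ?M \<le> card ?D" using sub by (intro card_mono) simp_all
  moreover have "real (card ?M) = below p a b"
    using card_prime_power_dvd[OF assms(1), of "Suc b" a] by (simp add: below_def)
  ultimately show ?thesis
    using card_prime_power_dvd[OF assms] by (simp add: of_nat_diff)
qed

section \<open>Inequalities for moving one exponent\<close>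

text \<open>The pair \<open>(x, y)\<close> becomes \<open>(q, r)\<close> at exponent
  \<open>0\<close>. The right side minus the left is
  \<open>(r - y) * (B - C) - (q - x) * (A - C)\<close>, and
  \<open>q - x \<le> p * (r - y)\<close>.\<close>

lemma exponent_zero_le:
  fixes p q r x y A B C :: real
  assumes "q = p * r" "p * y \<le> x" "y \<le> r" "C \<le> A" "p * (A - C) \<le> B - C"
  shows "q * A + (q - r) * B - (q - r) * C \<le> x * A + (q - y) * B - (x - y) * C"
proof -
  have "(q - x) * (A - C) \<le> (p * (r - y)) * (A - C)"
    using assms by (intro mult_right_mono) (simp_all add: algebra_simps)
  also have "\<dots> = (r - y) * (p * (A - C))" by simp
  also have "\<dots> \<le> (r - y) * (B - C)"
    using assms by (intro mult_left_mono) simp_all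
  finally show ?thesis by (simp add: algebra_simps)
qed

text \<open>With \<open>B = C\<close> the terms in \<open>y\<close> cancel and only
  \<open>x * (A - C)\<close> varies, so \<open>x = 1\<close> is best. The equality
  \<open>B = C\<close> arises when both other exponents are \<open>0\<close>.\<close>

lemma exponent_full_le:
  fixes q x y A B C :: real
  assumes "B = C" "C \<le> A" "1 \<le> x"
  shows "A + q * B - C \<le> x * A + (q - y) * B - (x - y) * C"
proof -
  have "0 \<le> (x - 1) * (A - C)" using assms by simp
  then show ?thesis using assms(1) by (simp add: algebra_simps)
qed

text \<open>The hypothesis of \<open>exponent_zero_le\<close> when the two other primes are \<open>P\<close>, with arbitrary
  exponent, and \<open>R\<close>, with positive exponent.\<close>

lemma gain_bound_two:
  fixes p P R q r x y q' x' y' :: real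
  assumes "p * P * R \<le> (P - 1) * (R\<^sup>2 - 1)" "1 \<le> p" "1 < P" "1 < R"
    and "q = P * r" "0 \<le> r" "x \<le> q" "0 \<le> y" "y \<le> r" "y \<le> x"
    and "R * x' \<le> q'" "R * y' \<le> x'" "0 \<le> x'" "0 \<le> y'" "y' \<le> x'"
  shows "p * (x * x' - (x - y) * (x' - y')) \<le> (q - y) * (q' - y') - (x - y) * (x' - y')"
proof -
  \<comment> \<open>Since \<open>q' \<ge> R * x'\<close> and \<open>y' \<le> x' / R\<close>, the
    difference \<open>q' - y'\<close> is at least \<open>(R - 1 / R) * x'\<close>.\<close>
  have "x' * (R\<^sup>2 - 1) \<le> R * (q' - y')"
  proof -
    have "R * (R * x') \<le> R * q'" using assms by (intro mult_left_mono) simp_all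
    then show ?thesis using assms(12) by (simp add: algebra_simps power2_eq_square)
  qed
  then have s': "(R\<^sup>2 - 1) * x' / R \<le> q' - y'"
    using assms(4) by (simp add: field_simps)
  have s: "(P - 1) * r \<le> q - y" using assms by (simp add: algebra_simps)
  have R2: "0 \<le> R\<^sup>2 - 1" using assms(4) by (simp add: power2_eq_square mult_ge1_I)
  have "p * (x * x') \<le> p * ((P * r) * x')"
    using assms by (intro mult_left_mono mult_right_mono) simp_all
  also have "\<dots> = (p * P * R) * (r * x' / R)" using assms(4) by simp
  also have "\<dots> \<le> ((P - 1) * (R\<^sup>2 - 1)) * (r * x' / R)"
    using assms by (intro mult_right_mono) simp_all
  also have "\<dots> = ((P - 1) * r) * ((R\<^sup>2 - 1) * x' / R)" by simp
  also have "\<dots> \<le> (q - y) * (q' - y')"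
    using s s' assms R2 by (intro mult_mono) simp_all
  finally have "p * (x * x') \<le> (q - y) * (q' - y')" .
  moreover have "0 \<le> (p - 1) * ((x - y) * (x' - y'))"
    using assms by (intro mult_nonneg_nonneg) simp_all
  ultimately show ?thesis by (simp add: algebra_simps)
qed

text \<open>The same hypothesis for the prime \<open>P\<close>, when the exponent of \<open>p\<close> is \<open>0\<close> and that of \<open>R\<close> is
  positive.\<close>

lemma gain_bound_one:
  fixes p P R q r q' x' y' :: real
  assumes "q = p * r" "2 \<le> p" "0 \<le> r" "0 \<le> P" "P + 2 \<le> R"
    and "R * x' \<le> q'" "R * y' \<le> x'" "0 \<le> x'" "0 \<le> y'"
  shows "P * (q * x' - (q - r) * (x' - y')) \<le> (q - r) * (q' - y') - (q - r) * (x' - y')"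
proof -
  define w where "w = q - r"
  have w: "r \<le> w" "0 \<le> w"
    using assms mult_right_mono[of 2 p r] by (simp_all add: w_def)
  have R: "0 < R" using assms by simp
  have y': "y' \<le> x' / R" using assms R by (simp add: field_simps)
  have "q * x' - (q - r) * (x' - y') = r * x' + w * y'"
    by (simp add: w_def algebra_simps)
  also have "\<dots> \<le> w * x' + w * (x' / R)"
    using w assms y' by (intro add_mono mult_mono) simp_all
  also have "\<dots> = w * x' * (R + 1) / R" using R by (simp add: field_simps)
  finally have "P * (q * x' - (q - r) * (x' - y')) \<le> P * (w * x' * (R + 1) / R)"
    using assms(4) by (rule mult_left_mono)
  also have "\<dots> = (w * x' / R) * (P * (R + 1))" by simp
  \<comment> \<open>The gap \<open>P + 2 \<le> R\<close> enters here, through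
    \<open>(R - 2) * (R + 1) = R * (R - 1) - 2\<close>.\<close>
  also have "\<dots> \<le> (w * x' / R) * (R * (R - 1))"
  proof (rule mult_left_mono)
    have "P * (R + 1) \<le> (R - 2) * (R + 1)"
      using assms R by (intro mult_right_mono) simp_all
    then show "P * (R + 1) \<le> R * (R - 1)" by (simp add: algebra_simps)
    show "0 \<le> w * x' / R" using w assms R by simp
  qed
  also have "\<dots> = w * (R * x' - x')" using R by (simp add: field_simps)
  also have "\<dots> \<le> w * (q' - x')"
    using w assms by (intro mult_left_mono) simp_all
  finally show ?thesis by (simp add: w_def algebra_simps)
qed

text \<open>Compares the degrees of \<open>p3 ^ a3\<close> (left) and \<open>p1 ^ a1\<close> (right).\<close>

lemma full_power_le:
  fixes p1 p2 p3 q1 q2 q3 r1 r2 r3 :: real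
  assumes "q1 = p1 * r1" "q2 = p2 * r2" "q3 = p3 * r3" "1 \<le> r1" "1 \<le> r2" "1 \<le> r3"
    and "2 \<le> p1" "p1 + 1 \<le> p2" "p2 + 1 \<le> p3"
  shows "q1 * q2 + (q1 - r1) * (q2 - r2) * (q3 - 1) \<le> q2 * q3 + (q1 - 1) * (q2 - r2) * (q3 - r3)"
proof -
  \<comment> \<open>Without the factor \<open>r1 * r2\<close>, the gap to be shown nonnegative is
    \<open>(p2 - 1) * (p3 - p1) * r3 - (p1 + p2 - 1)\<close>, and
    \<open>p1 + p2 - 1 \<le> 2 * (p2 - 1)\<close>.\<close>
  have "(p2 - 1) * 2 * 1 \<le> (p2 - 1) * (p3 - p1) * r3"
    using assms by (intro mult_mono) simp_all
  then have "p1 * p2 + (p1 - 1) * (p2 - 1) * (p3 * r3 - 1) \<le> p1 * (p2 - 1) * ((p3 - 1) * r3)"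
    using assms(7-9) by (simp add: algebra_simps)
  then have "(r1 * r2) * (p1 * p2 + (p1 - 1) * (p2 - 1) * (p3 * r3 - 1))
    \<le> (r1 * r2) * (p1 * (p2 - 1) * ((p3 - 1) * r3))"
    using assms(4,5) by (intro mult_left_mono) simp_all
  then have "q1 * q2 + (q1 - r1) * (q2 - r2) * (q3 - 1) \<le> q1 * (q2 - r2) * (q3 - r3)"
    using assms(1-3) by (simp add: algebra_simps)
  \<comment> \<open>With \<open>B = (q2 - r2) * (q3 - r3)\<close>, the right side of the goal is
    \<open>q1 * B + (q2 * q3 - B)\<close>.\<close>
  moreover have "(q2 - r2) * (q3 - r3) \<le> q2 * q3"
  proof (rule mult_mono)
    show "0 \<le> q2" "0 \<le> q3 - r3"
      using assms mult_right_mono[of 1 p3 r3] by simp_all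
  qed (use assms in simp_all)
  ultimately show ?thesis by (simp add: algebra_simps)
qed

section \<open>The closed formula for the degree and its minimum\<close>

lemma below_bounds:
  fixes p a b :: nat
  assumes "2 \<le> p" "b \<le> a" "0 < a"
  shows "0 \<le> below p a b" "p * below p a b \<le> real p ^ (a - b)"
    "below p a b \<le> real p ^ (a - b)" "below p a b \<le> real p ^ (a - 1)"
proof -
  show y: "0 \<le> below p a b" by (simp add: below_def)
  show py: "p * below p a b \<le> real p ^ (a - b)"
  proof (cases "b < a")
    case True
    then have "a - b = Suc (a - b - 1)" by simp
    then have "real p ^ (a - b) = p * real p ^ (a - b - 1)" by (metis power_Suc)
    then show ?thesis using True by (simp add: below_def)
  qed (simp add: below_def)
  show "below p a b \<le> real p ^ (a - b)"
    using mult_right_mono[of 1 "real p" "below p a b"] y py assms(1) by simp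
  show "below p a b \<le> real p ^ (a - 1)"
    using assms(1) by (simp add: below_def power_increasing diff_le_mono2)
qed

text \<open>The degree plus one, the vertex itself being counted: residues whose gcd with
  \<open>n\<close> is a multiple of the given one, plus those whose gcd divides it, minus those with
  the same gcd.\<close>

definition closed_degree ::
    "nat \<Rightarrow> nat \<Rightarrow> nat \<Rightarrow> nat \<Rightarrow> nat \<Rightarrow> nat \<Rightarrow> nat \<Rightarrow> nat \<Rightarrow> nat \<Rightarrow> real" where
  "closed_degree p1 a1 b1 p2 a2 b2 p3 a3 b3 =
     real p1 ^ (a1 - b1) * real p2 ^ (a2 - b2) * real p3 ^ (a3 - b3)
   + (real p1 ^ a1 - below p1 a1 b1) * (real p2 ^ a2 - below p2 a2 b2) * (real p3 ^ a3 - below p3 a3 b3)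
   - (real p1 ^ (a1 - b1) - below p1 a1 b1) * (real p2 ^ (a2 - b2) - below p2 a2 b2)
     * (real p3 ^ (a3 - b3) - below p3 a3 b3)"

lemma pg_deg_eq_closed_degree:
  fixes p1 p2 p3 a1 a2 a3 b1 b2 b3 n c :: nat
  assumes "prime p1" "prime p2" "prime p3" "p1 \<noteq> p2" "p1 \<noteq> p3" "p2 \<noteq> p3"
    and "b1 \<le> a1" "b2 \<le> a2" "b3 \<le> a3"
    and n: "n = p1 ^ a1 * p2 ^ a2 * p3 ^ a3" and "c < n"
    and g: "gcd c n = p1 ^ b1 * p2 ^ b2 * p3 ^ b3"
  shows "real (pg_deg n c) + 1 = closed_degree p1 a1 b1 p2 a2 b2 p3 a3 b3"
proof -
  have cop: "coprime (p1 ^ a1) (p2 ^ a2)" "coprime (p1 ^ a1 * p2 ^ a2) (p3 ^ a3)"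
    using assms(1-6) by (simp_all add: primes_coprime)
  have pos: "p1 ^ a1 > 0" "p2 ^ a2 > 0" "p3 ^ a3 > 0" "p1 ^ a1 * p2 ^ a2 > 0"
    using assms(1-3) by (simp_all add: prime_gt_0_nat)
  have dvd: "p1 ^ b1 dvd p1 ^ a1" "p2 ^ b2 dvd p2 ^ a2" "p3 ^ b3 dvd p3 ^ a3"
    using assms(7-9) by (simp_all add: le_imp_power_dvd)
  have dvd': "p1 ^ b1 * p2 ^ b2 dvd p1 ^ a1 * p2 ^ a2"
    using dvd(1,2) by (rule mult_dvd_mono)
  note c1 = cop(1) pos(1,2) dvd(1,2) and c2 = cop(2) pos(4,3) dvd' dvd(3)
  note cards = card_prime_power_dvd card_dvd_prime_power card_eq_prime_power
  show ?thesis
    unfolding pg_deg_real[OF \<open>c < n\<close>] g unfolding n closed_degree_def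
      card_dvd_gcd_mult[OF c1] card_dvd_gcd_mult[OF c2]
      card_gcd_dvd_mult[OF c1] card_gcd_dvd_mult[OF c2]
      card_gcd_eq_mult[OF c1] card_gcd_eq_mult[OF c2] of_nat_mult
      cards[OF assms(1,7)] cards[OF assms(2,8)] cards[OF assms(3,9)]
    by (rule refl)
qed

lemma closed_degree_lower_bound:
  fixes p1 p2 p3 a1 a2 a3 b1 b2 b3 :: nat
  assumes p: "2 \<le> p1" "p1 < p2" "p2 + 2 \<le> p3"
    and a: "0 < a1" "0 < a2" "0 < a3"
    and b: "b1 \<le> a1" "b2 \<le> a2" "b3 \<le> a3"
  shows "min (closed_degree p1 a1 0 p2 a2 a2 p3 a3 0) (closed_degree p1 a1 0 p2 a2 0 p3 a3 a3)
    \<le> closed_degree p1 a1 b1 p2 a2 b2 p3 a3 b3"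
proof -
  define q1 q2 q3 where q_def: "q1 = real p1 ^ a1" "q2 = real p2 ^ a2" "q3 = real p3 ^ a3"
  define r1 r2 r3 where r_def:
    "r1 = real p1 ^ (a1 - 1)" "r2 = real p2 ^ (a2 - 1)" "r3 = real p3 ^ (a3 - 1)"
  define x1 x2 x3 where x_def:
    "x1 = real p1 ^ (a1 - b1)" "x2 = real p2 ^ (a2 - b2)" "x3 = real p3 ^ (a3 - b3)"
  define y1 y2 y3 where y_def: "y1 = below p1 a1 b1" "y2 = below p2 a2 b2" "y3 = below p3 a3 b3"
  \<comment> \<open>In these variables exponent \<open>0\<close> is the pair \<open>(q, r)\<close>
    and full exponent is \<open>(1, 0)\<close>.\<close>
  define F where "F = (\<lambda>x1 y1 x2 y2 x3 y3. x1 * x2 * x3 + (q1 - y1) * (q2 - y2) * (q3 - y3)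
    - (x1 - y1) * (x2 - y2) * (x3 - y3))"
  have F_b: "closed_degree p1 a1 b1 p2 a2 b2 p3 a3 b3 = F x1 y1 x2 y2 x3 y3"
    by (simp add: closed_degree_def F_def q_def x_def y_def)
  have F_2: "closed_degree p1 a1 0 p2 a2 a2 p3 a3 0 = F q1 r1 1 0 q3 r3"
    using a by (simp add: closed_degree_def F_def q_def r_def below_def)
  have F_3: "closed_degree p1 a1 0 p2 a2 0 p3 a3 a3 = F q1 r1 q2 r2 1 0"
    using a by (simp add: closed_degree_def F_def q_def r_def below_def)

  have P: "2 \<le> p1" "2 \<le> p2" "2 \<le> p3" using p by simp_all
  have rP: "2 \<le> real p1" "real p1 + 1 \<le> real p2" "real p2 + 2 \<le> real p3" using p by linarith+
  have q: "q1 = p1 * r1" "q2 = p2 * r2" "q3 = p3 * r3"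
    using a by (simp_all add: q_def r_def power_eq_if)
  have r: "1 \<le> r1" "1 \<le> r2" "1 \<le> r3" using P by (simp_all add: r_def)
  have rq: "r1 \<le> q1" "r2 \<le> q2" "r3 \<le> q3"
    using P by (simp_all add: q_def r_def power_increasing)
  have x: "1 \<le> x1" "1 \<le> x2" "1 \<le> x3" using P by (simp_all add: x_def)
  have xq: "x1 \<le> q1" "x2 \<le> q2" "x3 \<le> q3"
    using P by (simp_all add: x_def q_def power_increasing)
  have y: "0 \<le> y1" "0 \<le> y2" "0 \<le> y3" "p1 * y1 \<le> x1" "p2 * y2 \<le> x2" "p3 * y3 \<le> x3"
    "y1 \<le> x1" "y2 \<le> x2" "y3 \<le> x3" "y1 \<le> r1" "y2 \<le> r2" "y3 \<le> r3"
    using below_bounds[OF P(1) b(1) a(1)] below_bounds[OF P(2) b(2) a(2)]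
      below_bounds[OF P(3) b(3) a(3)] by (simp_all add: x_def y_def r_def)
  have xp: "real p * real p ^ (e - f) \<le> real p ^ e" if "0 < f" "f \<le> e" "2 \<le> p" for p e f :: nat
    using that power_increasing[of "Suc (e - f)" e "real p"] by simp
  have xp2: "p2 * x2 \<le> q2" if "0 < b2" using that xp b P by (simp add: x_def q_def)
  have xp3: "p3 * x3 \<le> q3" if "0 < b3" using that xp b P by (simp add: x_def q_def)

  have prod_le: "(u - v) * (u' - v') \<le> u * u'" if "0 \<le> v" "v \<le> u" "0 \<le> v'" "v' \<le> u'"
    for u v u' v' :: real
    using that by (intro mult_mono) simp_all
  have first_to_zero: "F q1 r1 x2 y2 x3 y3 \<le> F x1 y1 x2 y2 x3 y3"
    if "p1 * (x2 * x3 - (x2 - y2) * (x3 - y3)) \<le> (q2 - y2) * (q3 - y3) - (x2 - y2) * (x3 - y3)"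
    using exponent_zero_le[OF q(1) y(4,10) prod_le[OF y(2,8) y(3,9)] that]
    by (simp add: F_def mult.assoc)

  show ?thesis
  proof (cases "b3 = 0")
    case False
    \<comment> \<open>Arithmetic input of \<open>gain_bound_two\<close> with \<open>P = p2\<close>,
      \<open>R = p3\<close>: here \<open>p1 \<le> p2 - 1\<close> and
      \<open>p2 \<le> p3 - 2\<close>.\<close>
    have "real p1 * p2 * p3 \<le> (real p2 - 1) * ((real p3)\<^sup>2 - 1)"
    proof -
      have "real p1 * (real p2 * p3) \<le> (real p2 - 1) * ((real p3)\<^sup>2 - 1)"
      proof (rule mult_mono)
        have "real p2 * p3 \<le> (real p3 - 2) * p3" using rP by (intro mult_right_mono) simp_all
        then show "real p2 * p3 \<le> (real p3)\<^sup>2 - 1"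
          using rP by (simp add: algebra_simps power2_eq_square)
      qed (use rP in simp_all)
      then show ?thesis by (simp add: mult.assoc)
    qed
    then have "F q1 r1 x2 y2 x3 y3 \<le> F x1 y1 x2 y2 x3 y3"
      using rP r q x xq y xp3 False
      by (intro first_to_zero gain_bound_two[where r = r2 and R = "real p3"]) auto
    moreover have "F q1 r1 q2 r2 x3 y3 \<le> F q1 r1 x2 y2 x3 y3"
    proof -
      have le: "(q1 - r1) * (x3 - y3) \<le> q1 * x3" using prod_le[of r1 q1 y3 x3] r rq y by simp
      have "p2 * (q1 * x3 - (q1 - r1) * (x3 - y3))
          \<le> (q1 - r1) * (q3 - y3) - (q1 - r1) * (x3 - y3)"
        using rP r q x y xp3 False
        by (intro gain_bound_one[where p = "real p1" and R = "real p3"]) auto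
      from exponent_zero_le[OF q(2) y(5,11) le this] show ?thesis
        by (simp add: F_def mult_ac)
    qed
    moreover have "F q1 r1 q2 r2 1 0 \<le> F q1 r1 q2 r2 x3 y3"
      using exponent_full_le[OF refl prod_le[of r1 q1 r2 q2] x(3), where q = q3 and y = y3] r rq
      by (simp add: F_def mult_ac)
    ultimately show ?thesis unfolding F_b F_3 by linarith
  next
    case b3: True
    then have xy3: "x3 = q3" "y3 = r3"
      using a by (simp_all add: x_def y_def q_def r_def below_def)
    show ?thesis
    proof (cases "b2 = 0")
      case False
      \<comment> \<open>Now \<open>p2\<close> has the positive exponent, so the roles are
        \<open>P = p3\<close>, \<open>R = p2\<close>; the input is
        \<open>p2 * p3 \<le> (p2 + 1) * (p3 - 1)\<close>.\<close>
      have "real p1 * p3 * p2 \<le> (real p3 - 1) * ((real p2)\<^sup>2 - 1)"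
      proof -
        have "real p1 * (real p2 * p3) \<le> (real p2 - 1) * ((real p2 + 1) * (real p3 - 1))"
          by (rule mult_mono) (use rP in \<open>simp_all add: algebra_simps\<close>)
        then show ?thesis by (simp add: algebra_simps power2_eq_square)
      qed
      then have "p1 * (x3 * x2 - (x3 - y3) * (x2 - y2))
          \<le> (q3 - y3) * (q2 - y2) - (x3 - y3) * (x2 - y2)"
        using rP r q x xq y xp2 False
        by (intro gain_bound_two[where r = r3 and R = "real p2"]) auto
      then have "F q1 r1 x2 y2 x3 y3 \<le> F x1 y1 x2 y2 x3 y3"
        by (intro first_to_zero) (simp add: mult_ac)
      moreover have "F q1 r1 1 0 x3 y3 \<le> F q1 r1 x2 y2 x3 y3"
        using exponent_full_le[OF refl prod_le[of r1 q1 r3 q3] x(2), where q = q2 and y = y2] r rq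
        by (simp add: F_def mult_ac xy3)
      ultimately show ?thesis unfolding F_b F_2 xy3 by linarith
    next
      case True
      then have xy2: "x2 = q2" "y2 = r2"
        using a by (simp_all add: x_def y_def q_def r_def below_def)
      have "F 1 0 x2 y2 x3 y3 \<le> F x1 y1 x2 y2 x3 y3"
        using exponent_full_le[OF refl prod_le[of r2 q2 r3 q3] x(1), where q = q1 and y = y1] r rq
        by (simp add: F_def mult_ac xy2 xy3)
      moreover have "F q1 r1 q2 r2 1 0 \<le> F 1 0 q2 r2 q3 r3"
        using full_power_le[OF q r rP(1,2)] rP(3) by (simp add: F_def algebra_simps)
      ultimately show ?thesis unfolding F_b F_3 xy2 xy3 by linarith
    qed
  qed
qed

section \<open>From exponent triples back to vertices\<close>

lemma dvd_three_prime_powers: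
  fixes p1 p2 p3 a1 a2 a3 d :: nat
  assumes "prime p1" "prime p2" "prime p3" "d dvd p1 ^ a1 * p2 ^ a2 * p3 ^ a3"
  obtains b1 b2 b3 where "b1 \<le> a1" "b2 \<le> a2" "b3 \<le> a3" "d = p1 ^ b1 * p2 ^ b2 * p3 ^ b3"
proof -
  obtain e d3 where d: "d = e * d3" "e dvd p1 ^ a1 * p2 ^ a2" "d3 dvd p3 ^ a3"
    using division_decomp[OF assms(4)] by blast
  obtain d1 d2 where e: "e = d1 * d2" "d1 dvd p1 ^ a1" "d2 dvd p2 ^ a2"
    using division_decomp[OF d(2)] by blast
  show thesis
    using d e that assms(1-3) by (auto simp: divides_primepow_nat)
qed

theorem theorem1p5:
  fixes p1 p2 p3 a1 a2 a3 n :: nat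
  assumes "prime p1" "prime p2" "prime p3"
    and "p1 < p2" "p2 < p3"
    and "a1 > 0" "a2 > 0" "a3 > 0"
    and "n = p1 ^ a1 * p2 ^ a2 * p3 ^ a3"
  shows "pg_min_deg n = min (pg_deg n (p2 ^ a2)) (pg_deg n (p3 ^ a3))"
proof -
  have p1: "2 \<le> p1" using assms(1) by (rule prime_ge_2_nat)
  have gap: "p2 + 2 \<le> p3"
  proof -
    \<comment> \<open>Both primes exceed \<open>p1 \<ge> 2\<close>, hence are odd and differ by at
      least \<open>2\<close>.\<close>
    have "odd p2" "odd p3" using assms(2-5) p1 by (simp_all add: prime_odd_nat)
    then have "p3 \<noteq> p2 + 1" by auto
    then show ?thesis using assms(5) by linarith
  qed
  have gt: "1 < p1 ^ a1" "1 < p2 ^ a2" "1 < p3 ^ a3"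
    using assms(1-3,6-8) one_less_power prime_gt_1_nat by blast+
  have lt2: "p2 ^ a2 < n" and lt3: "p3 ^ a3 < n"
  proof -
    have "1 < p1 ^ a1 * p3 ^ a3" "1 < p1 ^ a1 * p2 ^ a2"
      using gt less_1_mult by blast+
    then show "p2 ^ a2 < n" "p3 ^ a3 < n"
      using gt n_less_m_mult_n[of "p2 ^ a2" "p1 ^ a1 * p3 ^ a3"]
        n_less_m_mult_n[of "p3 ^ a3" "p1 ^ a1 * p2 ^ a2"] assms(2,3) unfolding assms(9)
      by (simp_all add: mult_ac prime_gt_0_nat)
  qed
  have deg: "real (pg_deg n c) + 1 = closed_degree p1 a1 b1 p2 a2 b2 p3 a3 b3"
    if "c < n" "b1 \<le> a1" "b2 \<le> a2" "b3 \<le> a3" "gcd c n = p1 ^ b1 * p2 ^ b2 * p3 ^ b3"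
    for c b1 b2 b3
    using that assms by (intro pg_deg_eq_closed_degree) simp_all
  have "p2 ^ a2 dvd n" "p3 ^ a3 dvd n" unfolding assms(9) by simp_all
  then have g: "gcd (p2 ^ a2) n = p2 ^ a2" "gcd (p3 ^ a3) n = p3 ^ a3"
    by (simp_all add: gcd_nat.absorb1)
  have d2: "real (pg_deg n (p2 ^ a2)) + 1 = closed_degree p1 a1 0 p2 a2 a2 p3 a3 0"
    using lt2 g by (intro deg) simp_all
  have d3: "real (pg_deg n (p3 ^ a3)) + 1 = closed_degree p1 a1 0 p2 a2 0 p3 a3 a3"
    using lt3 g by (intro deg) simp_all
  let ?m = "min (pg_deg n (p2 ^ a2)) (pg_deg n (p3 ^ a3))"
  have "?m \<le> pg_deg n c" if c: "c < n" for c
  proof -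
    obtain b1 b2 b3 where b: "b1 \<le> a1" "b2 \<le> a2" "b3 \<le> a3" "gcd c n = p1 ^ b1 * p2 ^ b2 * p3 ^ b3"
      using dvd_three_prime_powers[OF assms(1-3), of "gcd c n" a1 a2 a3] assms(9) gcd_dvd2 by metis
    have "min (real (pg_deg n (p2 ^ a2)) + 1) (real (pg_deg n (p3 ^ a3)) + 1) \<le> real (pg_deg n c) + 1"
      unfolding d2 d3 deg[OF c b]
      by (rule closed_degree_lower_bound[OF p1 assms(4) gap assms(6-8) b(1-3)])
    then show ?thesis by linarith
  qed
  moreover have "?m \<in> pg_deg n ` {0..<n}"
    using lt2 lt3 by (auto simp: min_def)
  ultimately show ?thesis
    unfolding pg_min_deg_def by (intro Min_eqI) auto
qed

end
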